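(* For any $u\in\mathbb{D}'$, $$\mathcal{F}(1;u,u,u)=-\frac13\log^3(1-u).$$
   Context: $\mathbb{D}'=\{z\in\mathbb{C}:0<|z|\le1,\ z\ne1\}$. For $\operatorname{Re}(z)>0$, $u,w\in\mathbb{C}\setminus((1,\infty)\cup\{0\})$ and $v\in\mathbb{C}\setminus([1,\infty)\cup\{0\})$, $$\mathcal{F}(z;u,v,w)=\int_0^1\frac{\log(1-ut^z)\log(1-wt^z)}{v^{-1}-t}\,dt,$$ where $\log$ is the complex logarithm; thus $\mathcal{F}(1;u,u,u)=\int_0^1\frac{\log^2(1-ut)}{u^{-1}-t}\,dt$. Here $\log^j(x)$ means $(\log x)^j$. *)

theory Defs
  imports "HOL-Analysis.Analysis"
begin

definition punctured_disc :: "complex set" where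
  "punctured_disc = {z. 0 < cmod z \<and> cmod z \<le> 1 \<and> z \<noteq> 1}"

text \<open>
  The intended domain is Re z > 0, u and w outside (1,\<infinity>) \<union> {0}, and v outside [1,\<infinity>) \<union> {0}.
  There the integrand is absolutely integrable, so that the Lebesgue integral agrees with the
  (possibly improper) integral. The logarithm and the power are the principal ones; the convention
  \<^term>\<open>Ln 0 = 0\<close> matters only on a null set.
\<close>
definition herglotz_F :: "complex \<Rightarrow> complex \<Rightarrow> complex \<Rightarrow> complex \<Rightarrow> complex" where
  "herglotz_F z u v w =
     (LINT t:{0..1}|lborel.
        Ln (1 - u * of_real t powr z) * Ln (1 - w * of_real t powr z) / (inverse v - of_real t))"

end

theory Submission
  imports Defs
begin

text \<open>
  With all three parameters equal to \<open>u\<close> and exponent 1, the integrand is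
  \<open>u * (Ln (1 - u * t))\<^sup>2 / (1 - u * t)\<close>, and this is the derivative of
  \<open>- (Ln (1 - u * t)) ^ 3 / 3\<close>. Since \<open>u * t\<close> stays in the closed unit disc and never
  meets 1, the segment from 1 to \<open>1 - u\<close> lies in the open right half-plane, where the
  principal logarithm is holomorphic. Hence the integrand is continuous on all of \<open>[0, 1]\<close>,
  up to the endpoint \<open>t = 1\<close> even when \<open>cmod u = 1\<close>, and the fundamental theorem of
  calculus applies; the lower endpoint contributes \<open>Ln 1 = 0\<close>.
\<close>

text \<open>
  The line \<open>Re z = 1\<close> touches the closed unit disc only at 1, so \<open>Re u < 1\<close>;
  scaling by \<open>t \<in> [0, 1]\<close> keeps the real part below 1.
\<close>
lemma Re_one_minus_mult_pos:
  assumes "cmod u \<le> 1" "u \<noteq> 1" "0 \<le> t" "t \<le> 1"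
  shows "0 < Re (1 - u * of_real t)"
proof -
  have "Re u \<le> 1"
    using complex_Re_le_cmod[of u] assms(1) by linarith
  have "Re u \<noteq> 1"
  proof
    assume "Re u = 1"
    moreover have "(Re u)\<^sup>2 + (Im u)\<^sup>2 \<le> 1"
      using assms(1) by (simp add: cmod_def)
    ultimately have "Im u = 0"
      by simp
    with \<open>Re u = 1\<close> assms(2) show False
      by (simp add: complex_eq_iff)
  qed
  with \<open>Re u \<le> 1\<close> have "Re u < 1"
    by simp
  have "Re u * t < 1"
  proof (cases "t = 1")
    case True
    with \<open>Re u < 1\<close> show ?thesis by simp
  next
    case False
    have "Re u * t \<le> 1 * t"
      using \<open>Re u \<le> 1\<close> assms(3) by (rule mult_right_mono)
    with False assms(4) show ?thesis by simp
  qed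
  then show ?thesis by simp
qed

lemma has_vector_derivative_Ln_one_minus_cubed:
  assumes "1 - u * of_real t \<notin> \<real>\<^sub>\<le>\<^sub>0"
  shows "((\<lambda>t. - (1 / 3) * Ln (1 - u * of_real t) ^ 3) has_vector_derivative
           u * Ln (1 - u * of_real t) ^ 2 / (1 - u * of_real t)) (at t within S)"
proof -
  have nz: "1 - u * of_real t \<noteq> 0"
    using assms by (metis nonpos_Reals_zero_I)
  have "((\<lambda>z. - (1 / 3) * Ln (1 - u * z) ^ 3) has_field_derivative
           u * Ln (1 - u * of_real t) ^ 2 / (1 - u * of_real t)) (at (of_real t))"
    using assms nz by (auto intro!: derivative_eq_intros simp: divide_simps power2_eq_square)
  then show ?thesis
    using has_vector_derivative_real_field has_vector_derivative_at_within by blast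
qed

theorem theorem2p6:
  fixes u :: complex
  assumes "u \<in> punctured_disc"
  shows "herglotz_F 1 u u u = - (1 / 3) * (Ln (1 - u)) ^ 3"
proof -
  from assms have u: "u \<noteq> 0" "cmod u \<le> 1" "u \<noteq> 1"
    by (auto simp: punctured_disc_def)
  have slit: "1 - u * of_real t \<notin> \<real>\<^sub>\<le>\<^sub>0" if "t \<in> {0..1}" for t :: real
    using Re_one_minus_mult_pos[of u t] u that
    by (auto simp: complex_nonpos_Reals_iff)
  then have nz: "1 - u * of_real t \<noteq> 0" if "t \<in> {0..1}" for t :: real
    using that by (metis nonpos_Reals_zero_I)
  let ?g = "\<lambda>t::real. u * Ln (1 - u * of_real t) ^ 2 / (1 - u * of_real t)"
  have cont: "continuous_on {0..1} ?g"
    using slit nz by (intro continuous_intros) auto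
  have "herglotz_F 1 u u u = (LINT t:{0..1}|lborel. ?g t)"
    unfolding herglotz_F_def
  proof (rule set_lebesgue_integral_cong)
    show "\<forall>t. t \<in> {0..1} \<longrightarrow>
        Ln (1 - u * of_real t powr 1) * Ln (1 - u * of_real t powr 1) / (inverse u - of_real t)
          = ?g t"
    proof (intro allI impI)
      fix t :: real
      have "inverse u - of_real t = (1 - u * of_real t) / u"
        using u(1) by (simp add: field_simps)
      then show "Ln (1 - u * of_real t powr 1) * Ln (1 - u * of_real t powr 1)
          / (inverse u - of_real t) = ?g t"
        by (simp add: power2_eq_square)
    qed
  qed simp
  also have "\<dots> = - (1 / 3) * Ln (1 - u * of_real 1) ^ 3 - - (1 / 3) * Ln (1 - u * of_real 0) ^ 3"
    unfolding set_lebesgue_integral_def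
    by (rule integral_FTC_atLeastAtMost[OF _ has_vector_derivative_Ln_one_minus_cubed cont])
       (use slit in auto)
  finally show ?thesis
    by simp
qed

end
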